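(* Let $G$ be a graph on $n$ vertices, and let $h,k$ be integers such that $1\le h\le k\le n/2$. If $\lambda$ is a Laplacian eigenvalue of $F_h(G)$ (an eigenvalue of the Laplacian matrix of $F_h(G)$), then $\lambda$ is a Laplacian eigenvalue of $F_k(G)$.
   Context: All graphs are finite and simple. For a graph $G$ with vertex set $[n]=\{1,\dots,n\}$ and $1\le k\le n$, the $k$-token graph $F_k(G)$ has as vertices the $k$-subsets of $[n]$; two vertices $A,B$ are adjacent iff $A\bigtriangleup B=\{a,b\}$ with $a\in A$, $b\in B$ and $\{a,b\}$ an edge of $G$. The Laplacian matrix of a graph is the diagonal degree matrix minus the adjacency matrix. *)

theory Defs
  imports
    "Graph_Theory.Pair_Digraph"
    "Jordan_Normal_Form.Char_Poly"
begin

text \<open>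
  A finite simple graph is a \<open>pair_graph\<close>: a finite loopless symmetric digraph whose arcs are
  ordered pairs, so the edge \<open>{a, b}\<close> is the pair of arcs \<open>(a, b)\<close> and \<open>(b, a)\<close>.
\<close>

definition token_graph :: "nat \<Rightarrow> 'a pair_pre_digraph \<Rightarrow> 'a set pair_pre_digraph" where
  "token_graph k G =
     \<lparr> pverts = {A. A \<subseteq> pverts G \<and> card A = k},
       parcs = {(A, B). A \<subseteq> pverts G \<and> card A = k \<and> B \<subseteq> pverts G \<and> card B = k \<and>
                  (\<exists>a b. a \<in> A \<and> b \<in> B \<and> (A - B) \<union> (B - A) = {a, b} \<and> (a, b) \<in> parcs G)} \<rparr>"

text \<open>
  Library matrices are indexed by natural numbers, so the matrices of a graph are taken with
  respect to an enumeration \<open>vs\<close> of its vertices.  In a symmetric digraph the out-degree is the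
  degree of the underlying undirected graph.
\<close>

definition degree_matrix :: "'v pair_pre_digraph \<Rightarrow> 'v list \<Rightarrow> real mat" where
  "degree_matrix H vs = mat (length vs) (length vs)
     (\<lambda>(i, j). if i = j then real (out_degree (with_proj H) (vs ! i)) else 0)"

definition adjacency_matrix :: "'v pair_pre_digraph \<Rightarrow> 'v list \<Rightarrow> real mat" where
  "adjacency_matrix H vs = mat (length vs) (length vs)
     (\<lambda>(i, j). if (vs ! i, vs ! j) \<in> parcs H then 1 else 0)"

definition laplacian_matrix :: "'v pair_pre_digraph \<Rightarrow> 'v list \<Rightarrow> real mat" where
  "laplacian_matrix H vs = degree_matrix H vs - adjacency_matrix H vs"

text \<open>The choice of enumeration is immaterial; see \<open>laplacian_eigenvalue_iff\<close> below.\<close>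

definition laplacian_eigenvalue :: "'v pair_pre_digraph \<Rightarrow> real \<Rightarrow> bool" where
  "laplacian_eigenvalue H x \<longleftrightarrow>
     (\<exists>vs. distinct vs \<and> set vs = pverts H \<and> eigenvalue (laplacian_matrix H vs) x)"

lemma pair_graph_token_graph:
  assumes "pair_graph G"
  shows "pair_graph (token_graph k G)"
proof -
  interpret pair_graph G by fact
  have fin: "finite (pverts (token_graph k G))"
    by (simp add: token_graph_def pair_finite_verts)
  have sub: "parcs (token_graph k G) \<subseteq> pverts (token_graph k G) \<times> pverts (token_graph k G)"
    by (auto simp: token_graph_def)
  have symG: "(b, a) \<in> parcs G" if "(a, b) \<in> parcs G" for a b
    using pair_sym_arcs that by (auto simp: symmetric_def dest: symD)
  have noloop: "A \<noteq> B" if "(A, B) \<in> parcs (token_graph k G)" for A B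
    using that by (auto simp: token_graph_def)
  have "sym (parcs (token_graph k G))"
  proof (rule symI)
    fix A B assume "(A, B) \<in> parcs (token_graph k G)"
    then obtain a b where *: "A \<subseteq> pverts G" "card A = k" "B \<subseteq> pverts G" "card B = k"
      "a \<in> A" "b \<in> B" "(A - B) \<union> (B - A) = {a, b}" "(a, b) \<in> parcs G"
      by (auto simp: token_graph_def)
    then have "(B - A) \<union> (A - B) = {b, a}" by auto
    with * symG[of a b] show "(B, A) \<in> parcs (token_graph k G)"
      unfolding token_graph_def by (simp, blast)
  qed
  then show ?thesis
    using fin sub noloop finite_subset[OF sub]
    by unfold_locales (auto simp: symmetric_def)
qed

lemma eigenvalue_laplacian_matrix_iff:
  assumes "distinct vs" "set vs = pverts H"
  shows "eigenvalue (laplacian_matrix H vs) x \<longleftrightarrow>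
    (\<exists>f. (\<exists>v\<in>pverts H. f v \<noteq> 0) \<and>
      (\<forall>v\<in>pverts H. real (out_degree (with_proj H) v) * f v
         - (\<Sum>w\<in>pverts H. if (v, w) \<in> parcs H then f w else 0) = x * f v))"
    (is "?L \<longleftrightarrow> ?R")
proof -
  let ?n = "length vs"
  let ?M = "laplacian_matrix H vs"
  have dim: "dim_row ?M = ?n" "dim_col ?M = ?n"
    by (simp_all add: laplacian_matrix_def adjacency_matrix_def)
  have bij: "bij_betw (\<lambda>i. vs ! i) {0..<?n} (pverts H)"
    using bij_betw_nth[OF assms(1), of "{0..<?n}" "pverts H"] assms(2)
    by (simp add: lessThan_atLeast0)
  have mv: "(?M *\<^sub>v vec ?n (\<lambda>i. f (vs ! i))) $ i =
      real (out_degree (with_proj H) (vs ! i)) * f (vs ! i)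
         - (\<Sum>w\<in>pverts H. if (vs ! i, w) \<in> parcs H then f w else 0)" if i: "i < ?n" for f i
  proof -
    have "(?M *\<^sub>v vec ?n (\<lambda>i. f (vs ! i))) $ i = (\<Sum>j = 0..<?n.
        (if i = j then real (out_degree (with_proj H) (vs ! i)) * f (vs ! i) else 0)
        - (if (vs ! i, vs ! j) \<in> parcs H then f (vs ! j) else 0))"
      using i dim by (auto simp: scalar_prod_def laplacian_matrix_def degree_matrix_def
          adjacency_matrix_def algebra_simps intro!: sum.cong)
    also have "\<dots> = real (out_degree (with_proj H) (vs ! i)) * f (vs ! i)
        - (\<Sum>j = 0..<?n. if (vs ! i, vs ! j) \<in> parcs H then f (vs ! j) else 0)"
      using i by (simp add: sum_subtractf)
    also have "(\<Sum>j = 0..<?n. if (vs ! i, vs ! j) \<in> parcs H then f (vs ! j) else 0)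
        = (\<Sum>w\<in>pverts H. if (vs ! i, w) \<in> parcs H then f w else 0)"
      using sum.reindex_bij_betw[OF bij, of "\<lambda>w. if (vs ! i, w) \<in> parcs H then f w else 0"] .
    finally show ?thesis .
  qed
  have all: "(\<forall>v\<in>pverts H. P v) \<longleftrightarrow> (\<forall>i<?n. P (vs ! i))" for P
    using assms(2) by (auto simp: all_set_conv_all_nth[symmetric])
  have ex: "(\<exists>v\<in>pverts H. P v) \<longleftrightarrow> (\<exists>i<?n. P (vs ! i))" for P
    using all[of "\<lambda>v. \<not> P v"] by blast
  have ev: "eigenvector ?M (vec ?n (\<lambda>i. f (vs ! i))) x \<longleftrightarrow>
    (\<exists>v\<in>pverts H. f v \<noteq> 0) \<and>
      (\<forall>v\<in>pverts H. real (out_degree (with_proj H) v) * f v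
         - (\<Sum>w\<in>pverts H. if (v, w) \<in> parcs H then f w else 0) = x * f v)" for f
    unfolding eigenvector_def all ex using mv[of _ f] dim by (auto simp: vec_eq_iff)
  show ?thesis
  proof
    assume ?L
    then obtain u where u: "eigenvector ?M u x" by (auto simp: eigenvalue_def)
    then have "dim_vec u = ?n" using dim by (auto simp: eigenvector_def)
    define f where "f v = u $ (the_inv_into {0..<?n} (\<lambda>i. vs ! i) v)" for v
    have "f (vs ! i) = u $ i" if "i < ?n" for i
      using that bij by (simp add: f_def the_inv_into_f_f bij_betw_def)
    with \<open>dim_vec u = ?n\<close> have "u = vec ?n (\<lambda>i. f (vs ! i))" by (auto simp: vec_eq_iff)
    with u have "eigenvector ?M (vec ?n (\<lambda>i. f (vs ! i))) x" by simp
    then show ?R unfolding ev by blast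
  next
    assume ?R
    then show ?L unfolding ev[symmetric] eigenvalue_def by blast
  qed
qed

lemma laplacian_eigenvalue_iff:
  assumes "distinct vs" "set vs = pverts H"
  shows "laplacian_eigenvalue H x \<longleftrightarrow> eigenvalue (laplacian_matrix H vs) x"
  unfolding laplacian_eigenvalue_def
  using assms eigenvalue_laplacian_matrix_iff[of _ H x] by blast

end

theory Submission
  imports Defs
begin

text \<open>
  Acting on functions of vertex sets, twice the Laplacian of a token graph is the sum over all arcs
  \<open>(a, b)\<close> of \<open>1 - \<tau>\<close>, where \<open>\<tau>\<close> swaps \<open>a\<close> and \<open>b\<close>. The operator \<open>up\<close>, which sums a function
  on \<open>k\<close>-sets over the \<open>k\<close>-subsets of a \<open>(k+1)\<close>-set, commutes with every permutation of the
  vertices, so it maps eigenfunctions to solutions of the eigenvalue equation. It is injective for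
  \<open>2k < n\<close>: with its adjoint \<open>down\<close> one has \<open>down up - up down = n - 2k\<close> on \<open>k\<close>-sets, so that
  \<open>\<parallel>up f\<parallel>\<^sup>2 = \<parallel>down f\<parallel>\<^sup>2 + (n - 2k) \<parallel>f\<parallel>\<^sup>2\<close>.
\<close>

section \<open>Raising and lowering operators on functions of vertex sets\<close>

definition up :: "('a set \<Rightarrow> real) \<Rightarrow> 'a set \<Rightarrow> real" where
  "up f B = (\<Sum>b\<in>B. f (B - {b}))"

definition down :: "'a set \<Rightarrow> ('a set \<Rightarrow> real) \<Rightarrow> 'a set \<Rightarrow> real" where
  "down V f C = (\<Sum>c\<in>V - C. f (insert c C))"

text \<open>Summing over all of \<open>E\<close>, not only the arcs leaving \<open>A\<close>, keeps
  the index set independent of \<open>A\<close>; this is what lets the operator commute with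
  \<open>up\<close>.\<close>

definition swap_laplacian :: "('a \<times> 'a) set \<Rightarrow> ('a set \<Rightarrow> real) \<Rightarrow> 'a set \<Rightarrow> real" where
  "swap_laplacian E f A = (\<Sum>(a, b)\<in>E. f A - f (transpose a b ` A))"

lemma up_image:
  assumes "inj p"
  shows "up f (p ` B) = up (\<lambda>A. f (p ` A)) B"
proof -
  have "up f (p ` B) = (\<Sum>b\<in>B. f (p ` B - {p b}))"
    unfolding up_def using assms by (subst sum.reindex) (auto intro: inj_on_subset)
  also have "\<dots> = (\<Sum>b\<in>B. f (p ` (B - {b})))"
    using assms by (simp add: image_set_diff)
  finally show ?thesis by (simp add: up_def)
qed

text \<open>Each transposition is injective and so passes through \<open>up\<close> by
  \<open>up_image\<close>; the sums over arcs and over deleted elements are then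
  interchanged.\<close>

lemma swap_laplacian_up: "swap_laplacian E (up f) B = up (swap_laplacian E f) B"
proof -
  have "swap_laplacian E (up f) B =
      (\<Sum>e\<in>E. \<Sum>c\<in>B. case e of (a, b) \<Rightarrow> f (B - {c}) - f (transpose a b ` (B - {c})))"
    unfolding swap_laplacian_def up_image[OF inj_transpose]
    by (intro sum.cong) (auto simp: up_def sum_subtractf)
  also have "\<dots> = up (swap_laplacian E f) B"
    unfolding up_def swap_laplacian_def by (rule sum.swap)
  finally show ?thesis .
qed

text \<open>Both composites contain the same sum \<open>?S\<close> over exchanges of some
  \<open>a\<close> in \<open>A\<close> for some \<open>b\<close> outside. They differ in how often
  \<open>A\<close> itself returns: once per element of \<open>V - A\<close> for \<open>down\<close>
  after \<open>up\<close>, once per element of \<open>A\<close> for \<open>up\<close> after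
  \<open>down\<close>.\<close>

lemma down_up_commutator:
  assumes "finite V" "A \<subseteq> V"
  shows "down V (up f) A = up (down V f) A + (real (card V) - 2 * real (card A)) * f A"
proof -
  have finA: "finite A" using assms finite_subset by blast
  let ?S = "\<Sum>b\<in>V - A. \<Sum>a\<in>A. f (insert b (A - {a}))"
  have "up f (insert b A) = f A + (\<Sum>a\<in>A. f (insert b (A - {a})))" if "b \<in> V - A" for b
  proof -
    have "(\<Sum>a\<in>A. f (insert b A - {a})) = (\<Sum>a\<in>A. f (insert b (A - {a})))"
      using that by (intro sum.cong arg_cong[of _ _ f]) auto
    then show ?thesis using that finA by (simp add: up_def)
  qed
  then have "down V (up f) A = real (card (V - A)) * f A + ?S"
    by (simp add: down_def sum.distrib)
  moreover have "down V f (A - {a}) = f A + (\<Sum>b\<in>V - A. f (insert b (A - {a})))" if "a \<in> A" for a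
  proof -
    have "V - (A - {a}) = insert a (V - A)" using that assms by auto
    then show ?thesis using that assms by (simp add: down_def insert_absorb)
  qed
  then have "up (down V f) A = real (card A) * f A + ?S"
    by (simp add: up_def sum.distrib sum.swap[of _ A])
  moreover have "real (card (V - A)) = real (card V) - real (card A)"
    using assms finA by (simp add: card_Diff_subset card_mono of_nat_diff)
  ultimately show ?thesis by (simp add: algebra_simps)
qed

text \<open>Both sides count pairs of a set and a one-element extension of it. Writing
  \<open>Suc (card C) = k\<close> instead of \<open>card C = k - 1\<close> makes the right side
  empty for \<open>k = 0\<close>, matching \<open>up g {} = 0\<close>.\<close>

lemma sum_up_down_adjoint:
  assumes "finite V"
  shows "(\<Sum>A | A \<subseteq> V \<and> card A = k. f A * up g A) =
    (\<Sum>C | C \<subseteq> V \<and> Suc (card C) = k. down V f C * g C)"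
proof -
  have fin: "finite {A. A \<subseteq> V \<and> P A}" for P using assms by simp
  have finD: "finite C" if "C \<subseteq> V" for C using assms that finite_subset by blast
  have "(\<Sum>A | A \<subseteq> V \<and> card A = k. f A * up g A) =
     (\<Sum>(A, a)\<in>(SIGMA A:{A. A \<subseteq> V \<and> card A = k}. A). f A * g (A - {a}))"
    using fin finD by (simp add: up_def sum_distrib_left sum.Sigma)
  also have "\<dots> = (\<Sum>(C, c)\<in>(SIGMA C:{C. C \<subseteq> V \<and> Suc (card C) = k}. V - C). f (insert c C) * g C)"
    by (rule sum.reindex_bij_witness[of _ "\<lambda>(C, c). (insert c C, c)" "\<lambda>(A, a). (A - {a}, a)"])
       (auto simp: insert_absorb finD card_Suc_Diff1 simp del: card_Diff_singleton card_Diff_insert)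
  also have "\<dots> = (\<Sum>C | C \<subseteq> V \<and> Suc (card C) = k. down V f C * g C)"
    using fin assms by (simp add: down_def sum_distrib_right sum.Sigma)
  finally show ?thesis .
qed

lemma up_injective:
  assumes fin: "finite V" and k: "2 * k < card V"
    and zero: "\<And>B. B \<subseteq> V \<Longrightarrow> card B = Suc k \<Longrightarrow> up f B = 0"
    and A: "A \<subseteq> V" "card A = k"
  shows "f A = 0"
proof -
  let ?F = "{A. A \<subseteq> V \<and> card A = k}"
  let ?c = "real (card V) - 2 * real k"
  have c: "?c > 0" using k by simp
  have finF: "finite ?F" using fin by simp
  have "up (down V f) X = - ?c * f X" if "X \<in> ?F" for X
  proof -
    have "finite X" using that fin finite_subset by auto
    then have "down V (up f) X = 0"
      unfolding down_def using that by (intro sum.neutral ballI zero) auto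
    then show ?thesis using down_up_commutator[OF fin, of X f] that by (auto simp: algebra_simps)
  qed
  then have "- ?c * (\<Sum>X\<in>?F. (f X)\<^sup>2) = (\<Sum>X\<in>?F. f X * up (down V f) X)"
    unfolding sum_distrib_left by (intro sum.cong) (auto simp: power2_eq_square)
  \<comment> \<open>Adjointness with \<open>g = down V f\<close> turns the pairing into a sum of
    squares, so a negative multiple of the squared norm of \<open>f\<close> is nonnegative.\<close>
  also have "\<dots> = (\<Sum>C | C \<subseteq> V \<and> Suc (card C) = k. (down V f C)\<^sup>2)"
    by (simp add: sum_up_down_adjoint[OF fin] power2_eq_square)
  also have "\<dots> \<ge> 0" by (intro sum_nonneg) auto
  finally have "?c * (\<Sum>X\<in>?F. (f X)\<^sup>2) \<le> 0" by (simp only: mult_minus_left neg_0_le_iff_le)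
  then have "(\<Sum>X\<in>?F. (f X)\<^sup>2) \<le> 0" using c by (simp add: mult_le_0_iff)
  then have "(\<Sum>X\<in>?F. (f X)\<^sup>2) = 0" by (intro antisym sum_nonneg) auto
  then show ?thesis using finF A by (simp add: sum_nonneg_eq_0_iff)
qed

section \<open>The token graph Laplacian as a sum over swaps\<close>

lemma transpose_image_exchange:
  assumes "a \<in> A" "b \<notin> A"
  shows "transpose a b ` A = insert b (A - {a})"
  using assms by (auto simp: transpose_def image_iff)

lemma transpose_image_same:
  assumes "a \<in> A \<longleftrightarrow> b \<in> A"
  shows "transpose a b ` A = A"
  using assms by (auto simp: transpose_def image_iff)

text \<open>A neighbour \<open>B\<close> arises from \<open>A\<close> by moving one token along an
  arc, and the arc is recovered from \<open>A - B = {a}\<close> and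
  \<open>B - A = {b}\<close>.\<close>

lemma token_graph_neighbours:
  assumes G: "pair_graph G" and A: "A \<subseteq> pverts G" "card A = k"
  shows "bij_betw (\<lambda>(a, b). transpose a b ` A) {(a, b)\<in>parcs G. a \<in> A \<and> b \<notin> A}
    {B. (A, B) \<in> parcs (token_graph k G)}"
proof -
  interpret pair_graph G by fact
  let ?P = "{(a, b)\<in>parcs G. a \<in> A \<and> b \<notin> A}"
  have finA: "finite A" using A finite_subset pair_finite_verts by blast
  \<comment> \<open>The bijection is proved for this exchange form and carried back to
    transpositions at the end.\<close>
  have img: "(case e of (a, b) \<Rightarrow> transpose a b ` A) = insert (snd e) (A - {fst e})"
    if "e \<in> ?P" for e
    using that by (cases e) (simp add: transpose_image_exchange)
  have "bij_betw (\<lambda>e. insert (snd e) (A - {fst e})) ?P {B. (A, B) \<in> parcs (token_graph k G)}"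
  proof (rule bij_betw_imageI)
    show "inj_on (\<lambda>e. insert (snd e) (A - {fst e})) ?P"
    proof (rule inj_onI)
      fix e e' assume e: "e \<in> ?P" "e' \<in> ?P"
        and eq: "insert (snd e) (A - {fst e}) = insert (snd e') (A - {fst e'})"
      have "A - insert (snd e) (A - {fst e}) = {fst e}" "insert (snd e) (A - {fst e}) - A = {snd e}"
        "A - insert (snd e') (A - {fst e'}) = {fst e'}" "insert (snd e') (A - {fst e'}) - A = {snd e'}"
        using e by auto
      with eq show "e = e'" by (simp add: prod_eq_iff)
    qed
    show "(\<lambda>e. insert (snd e) (A - {fst e})) ` ?P = {B. (A, B) \<in> parcs (token_graph k G)}"
    proof (intro subset_antisym subsetI)
      fix B assume "B \<in> (\<lambda>e. insert (snd e) (A - {fst e})) ` ?P"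
      then obtain a b where ab: "(a, b) \<in> parcs G" "a \<in> A" "b \<notin> A" and B: "B = insert b (A - {a})"
        by auto
      have "card B = k" unfolding B A(2)[symmetric] card_Suc_Diff1[OF finA ab(2), symmetric]
        using ab finA by (intro card_insert_disjoint) auto
      moreover have "B \<subseteq> pverts G" using A ab in_arcsD2 B by auto
      moreover have "(A - B) \<union> (B - A) = {a, b}" using ab B by auto
      moreover have "b \<in> B" using B by simp
      ultimately show "B \<in> {B. (A, B) \<in> parcs (token_graph k G)}"
        using A ab by (simp add: token_graph_def) blast
    next
      fix B assume "B \<in> {B. (A, B) \<in> parcs (token_graph k G)}"
      then obtain a b where ab: "a \<in> A" "b \<in> B" "(A - B) \<union> (B - A) = {a, b}" "(a, b) \<in> parcs G"
        by (auto simp: token_graph_def)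
      then have "a \<notin> B" "b \<notin> A" by blast+
      moreover from this have "B = insert b (A - {a})" using ab by blast
      ultimately show "B \<in> (\<lambda>e. insert (snd e) (A - {fst e})) ` ?P"
        using ab by (intro image_eqI[of _ _ "(a, b)"]) auto
    qed
  qed
  then show ?thesis by (rule iffD2[OF bij_betw_cong, rotated]) (rule img)
qed

text \<open>Arcs with both or neither endpoint in \<open>A\<close> fix \<open>A\<close> and
  contribute 0. Reversal matches arcs entering \<open>A\<close> with arcs leaving it and keeps the
  transposition, hence the factor 2.\<close>

lemma swap_laplacian_eq_cut_sum:
  assumes "finite E" "sym E"
  shows "swap_laplacian E f A =
    2 * (\<Sum>(a, b)\<in>{(a, b)\<in>E. a \<in> A \<and> b \<notin> A}. f A - f (transpose a b ` A))"
proof -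
  let ?g = "\<lambda>(a, b). f A - f (transpose a b ` A)"
  let ?P = "{(a, b)\<in>E. a \<in> A \<and> b \<notin> A}" and ?Q = "{(a, b)\<in>E. a \<notin> A \<and> b \<in> A}"
  have sub: "?P \<union> ?Q \<subseteq> E" by auto
  have fin: "finite ?P" "finite ?Q" using assms(1) by (auto intro: finite_subset[of _ E])
  have "sum ?g E = sum ?g (?P \<union> ?Q)"
  proof (rule sum.mono_neutral_right[OF assms(1) sub], rule ballI)
    fix e assume "e \<in> E - (?P \<union> ?Q)"
    then show "?g e = 0" by (cases e) (auto simp: transpose_image_same)
  qed
  also have "\<dots> = sum ?g ?P + sum ?g ?Q"
    using fin by (intro sum.union_disjoint) auto
  also have "sum ?g ?Q = sum ?g ?P"
    using assms(2)
    by (intro sum.reindex_bij_witness[of _ prod.swap prod.swap])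
       (auto dest: symD simp: transpose_commute)
  finally show ?thesis by (simp add: swap_laplacian_def)
qed

text \<open>The right side does not mention \<open>k\<close>: one operator describes the Laplacians
  of all token graphs of \<open>G\<close>, so that different \<open>k\<close> can be
  compared.\<close>

lemma token_graph_laplacian:
  assumes G: "pair_graph G" and A: "A \<in> pverts (token_graph k G)"
  shows "2 * (real (out_degree (with_proj (token_graph k G)) A) * f A
      - (\<Sum>B\<in>pverts (token_graph k G). if (A, B) \<in> parcs (token_graph k G) then f B else 0))
    = swap_laplacian (parcs G) f A"
proof -
  interpret pair_graph G by fact
  interpret T: pair_graph "token_graph k G" using G by (rule pair_graph_token_graph)
  let ?N = "{B. (A, B) \<in> parcs (token_graph k G)}"
  have A': "A \<subseteq> pverts G" "card A = k" using A by (auto simp: token_graph_def)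
  have inj_Pair1: "inj_on (Pair A) ?N" by (simp add: inj_on_def)
  have N: "?N \<subseteq> pverts (token_graph k G)" using T.in_arcsD2 by auto
  have "out_arcs (with_proj (token_graph k G)) A = Pair A ` ?N"
    by (auto simp: out_arcs_def)
  then have deg: "out_degree (with_proj (token_graph k G)) A = card ?N"
    unfolding out_degree_def by (simp only: card_image[OF inj_Pair1])
  have "(\<Sum>B\<in>pverts (token_graph k G). if (A, B) \<in> parcs (token_graph k G) then f B else 0) = sum f ?N"
    using N T.pair_finite_verts by (simp add: sum.If_cases Int_absorb1)
  then have "real (out_degree (with_proj (token_graph k G)) A) * f A
      - (\<Sum>B\<in>pverts (token_graph k G). if (A, B) \<in> parcs (token_graph k G) then f B else 0)
    = (\<Sum>B\<in>?N. f A - f B)"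
    by (simp add: deg sum_subtractf)
  also have "\<dots> = (\<Sum>(a, b)\<in>{(a, b)\<in>parcs G. a \<in> A \<and> b \<notin> A}. f A - f (transpose a b ` A))"
    using sum.reindex_bij_betw[OF token_graph_neighbours[OF G A'], of "\<lambda>B. f A - f B"]
    by (simp add: case_prod_unfold)
  finally have cut: "real (out_degree (with_proj (token_graph k G)) A) * f A
      - (\<Sum>B\<in>pverts (token_graph k G). if (A, B) \<in> parcs (token_graph k G) then f B else 0)
    = \<dots>" .
  have "sym (parcs G)" using pair_sym_arcs by (simp add: symmetric_def)
  then show ?thesis
    unfolding cut by (rule swap_laplacian_eq_cut_sum[OF pair_finite_arcs, symmetric])
qed

section \<open>Passing eigenvalues from \<open>k\<close> to \<open>k + 1\<close>\<close>

lemma laplacian_eigenvalue_token_graph_iff: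
  assumes G: "pair_graph G"
  shows "laplacian_eigenvalue (token_graph k G) x \<longleftrightarrow>
    (\<exists>f. (\<exists>A. A \<subseteq> pverts G \<and> card A = k \<and> f A \<noteq> 0) \<and>
      (\<forall>A. A \<subseteq> pverts G \<and> card A = k \<longrightarrow> swap_laplacian (parcs G) f A = 2 * x * f A))"
proof -
  let ?T = "token_graph k G"
  interpret T: pair_graph ?T using G by (rule pair_graph_token_graph)
  obtain vs where vs: "set vs = pverts ?T" "distinct vs"
    using finite_distinct_list[OF T.pair_finite_verts] by blast
  have V: "A \<in> pverts ?T \<longleftrightarrow> A \<subseteq> pverts G \<and> card A = k" for A
    by (simp add: token_graph_def)
  have double: "2 * c = 2 * d \<longleftrightarrow> c = d" for c d :: real by simp
  have eq: "real (out_degree (with_proj ?T) A) * f A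
      - (\<Sum>B\<in>pverts ?T. if (A, B) \<in> parcs ?T then f B else 0) = x * f A
    \<longleftrightarrow> swap_laplacian (parcs G) f A = 2 * x * f A" if "A \<in> pverts ?T" for f A
    unfolding token_graph_laplacian[OF G that, symmetric] mult.assoc double ..
  have "laplacian_eigenvalue ?T x \<longleftrightarrow> (\<exists>f. (\<exists>A\<in>pverts ?T. f A \<noteq> 0) \<and>
      (\<forall>A\<in>pverts ?T. swap_laplacian (parcs G) f A = 2 * x * f A))"
    unfolding laplacian_eigenvalue_iff[OF vs(2,1)] eigenvalue_laplacian_matrix_iff[OF vs(2,1)]
    by (intro ex_cong1 arg_cong2[of _ _ _ _ "(\<and>)"] refl ball_cong eq)
  then show ?thesis unfolding Bex_def Ball_def V conj_assoc .
qed

lemma laplacian_eigenvalue_token_graph_Suc: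
  assumes G: "pair_graph G" and k: "2 * k < card (pverts G)"
    and ev: "laplacian_eigenvalue (token_graph k G) x"
  shows "laplacian_eigenvalue (token_graph (Suc k) G) x"
proof -
  interpret pair_graph G by fact
  obtain f A where A: "A \<subseteq> pverts G" "card A = k" "f A \<noteq> 0"
    and f: "\<And>A. A \<subseteq> pverts G \<Longrightarrow> card A = k \<Longrightarrow> swap_laplacian (parcs G) f A = 2 * x * f A"
    using ev unfolding laplacian_eigenvalue_token_graph_iff[OF G] by blast
  have "\<exists>B. B \<subseteq> pverts G \<and> card B = Suc k \<and> up f B \<noteq> 0"
    using up_injective[OF pair_finite_verts k, of f A] A by blast
  moreover have "swap_laplacian (parcs G) (up f) B = 2 * x * up f B"
    if "B \<subseteq> pverts G" "card B = Suc k" for B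
    \<comment> \<open>Every \<open>B - {b}\<close> with \<open>b\<close> in \<open>B\<close> is a
      \<open>k\<close>-subset, so the eigenvalue equation of \<open>f\<close> applies term by
      term.\<close>
    unfolding swap_laplacian_up up_def sum_distrib_left
    using that by (intro sum.cong refl f) auto
  ultimately show ?thesis
    unfolding laplacian_eigenvalue_token_graph_iff[OF G] by blast
qed

theorem theorem4p1:
  fixes G :: "nat pair_pre_digraph" and n h k :: nat and x :: real
  assumes "pair_graph G"
    and "pverts G = {1..n}"
    and "1 \<le> h" and "h \<le> k" and "real k \<le> real n / 2"
    and "laplacian_eigenvalue (token_graph h G) x"
  shows "laplacian_eigenvalue (token_graph k G) x"
  using assms(4,5)
proof (induction k rule: dec_induct)
  case base
  show ?case by (rule assms(6))
next
  case (step m)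
  \<comment> \<open>The bound takes part in the induction: at \<open>Suc m\<close> it gives
    \<open>2 * m + 2 \<le> n\<close>, hence the strict inequality needed to step up from
    \<open>m\<close>.\<close>
  then show ?case
    using assms(1,2) by (intro laplacian_eigenvalue_token_graph_Suc) auto
qed

end
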